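(* Let $r,d$ be positive integers and let $A$ be an arrangement of at least $(r-1)(d+1)+1$ hyperplanes in $\mathbb{R}^d$. Then there exist a point $q\in\mathbb{R}^d$ and a partition of $A$ into $r$ parts $A_1,\dots,A_r$ such that $\mathrm{RD}(A_j,q)\geq 1$ for every $j=1,\dots,r$.
   Context: A hyperplane arrangement is a finite set of affine hyperplanes in $\mathbb{R}^d$. For an arrangement $A$ and a query point $q\in\mathbb{R}^d$, the regression depth $\mathrm{RD}(A,q)$ is the minimum, over all (closed) rays emanating from $q$, of the number of hyperplanes of $A$ that the ray intersects or is parallel to. In particular, if $q$ lies on a hyperplane $h$, every ray from $q$ intersects $h$. *)

theory Defs
  imports "HOL-Analysis.Analysis"
begin

definition is_hyperplane :: "'a::euclidean_space set \<Rightarrow> bool" where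
  "is_hyperplane H \<longleftrightarrow> (\<exists>a b. a \<noteq> 0 \<and> H = {x. a \<bullet> x = b})"

definition arrangement :: "'a::euclidean_space set set \<Rightarrow> bool" where
  "arrangement A \<longleftrightarrow> finite A \<and> (\<forall>H\<in>A. is_hyperplane H)"

definition ray :: "'a::euclidean_space \<Rightarrow> 'a \<Rightarrow> 'a set" where
  "ray q v = {q + t *\<^sub>R v | t. t \<ge> 0}"

text \<open>The ray from q in direction v intersects H or is parallel to H
  (its direction is parallel to H, i.e. translating H by v leaves it invariant).\<close>
definition ray_hits :: "'a::euclidean_space \<Rightarrow> 'a \<Rightarrow> 'a set \<Rightarrow> bool" where
  "ray_hits q v H \<longleftrightarrow> ray q v \<inter> H \<noteq> {} \<or> (\<forall>x\<in>H. x + v \<in> H)"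

definition regression_depth :: "'a::euclidean_space set set \<Rightarrow> 'a \<Rightarrow> nat" where
  "regression_depth A q = (INF v \<in> {v. v \<noteq> 0}. card {H \<in> A. ray_hits q v H})"

end

(* Write hyperplane i as a_i . x = b_i and let s_i(q) = b_i - a_i . q.  A ray from q in direction v
   hits or is parallel to it iff s_i(q) (a_i . v) >= 0, so a part has positive depth at q iff one
   of its hyperplanes contains q or 0 is a convex combination of the vectors sgn(s_i(q)) a_i.

   For fixed q, Sarkaria's tensor trick turns the search for a partition with equal combinations
   in all r parts into a colourful Caratheodory problem with (r-1)(d+1)+1 colours in dimension
   (r-1)(d+1), one colour per hyperplane.  That problem has a proof by Brouwer's theorem in the
   dual space: cover it by (r-1)(d+1)+1 families of disjoint cubes, one family per colour, and on
   each cube push inwards with a fixed vector of that colour.  Here q is added as d further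
   coordinates, driven by the vectors sgn(s_i(q)) a_i themselves, which makes the common
   combination vanish.  On each cube the part chosen for hyperplane i depends on q only through the
   sign of s_i(q), so in the solution only hyperplanes through q can be used by two parts at
   once.  Such a hyperplane serves one of the two parts alone, and the remainders of the two parts
   are merged, in which its two opposite contributions cancel.  This works for every r, without
   any equivariance. *)

theory Submission
  imports Defs
begin

section \<open>Fixed points in boxes from Kuhn's combinatorial lemma\<close>

section \<open>A variational inequality on cubes\<close>

lemma tendsto_fun_iff:
  fixes x :: "'m \<Rightarrow> 'i \<Rightarrow> 'b::topological_space"
  shows "(x \<longlongrightarrow> L) F \<longleftrightarrow> (\<forall>i. ((\<lambda>m. x m i) \<longlongrightarrow> L i) F)"
proof -
  have "(x \<longlongrightarrow> L) F \<longleftrightarrow> limitin (product_topology (\<lambda>i. euclidean) UNIV) x L F"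
    by (simp add: euclidean_product_topology limitin_canonical_iff)
  also have "\<dots> \<longleftrightarrow> (\<forall>i. ((\<lambda>m. x m i) \<longlongrightarrow> L i) F)"
    by (simp add: limitin_componentwise limitin_canonical_iff)
  finally show ?thesis .
qed

text \<open>Bolzano-Weierstrass, one coordinate at a time; values outside \<open>I\<close> are
  unconstrained and need not converge.\<close>

lemma bounded_finite_convergent_subseq:
  fixes u :: "nat \<Rightarrow> 'i \<Rightarrow> real"
  assumes "finite I" "\<And>m i. i \<in> I \<Longrightarrow> u m i \<in> {lo..hi}"
  obtains \<phi> L where "strict_mono (\<phi> :: nat \<Rightarrow> nat)" "\<And>i. i \<in> I \<Longrightarrow> (\<lambda>m. u (\<phi> m) i) \<longlonglongrightarrow> L i"
proof -
  have "\<exists>\<phi> L. strict_mono (\<phi> :: nat \<Rightarrow> nat) \<and> (\<forall>i\<in>I. (\<lambda>m. u (\<phi> m) i) \<longlonglongrightarrow> L i)"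
    using assms
  proof (induction I)
    case empty
    show ?case by (auto intro: exI[of _ id] strict_mono_id)
  next
    case (insert k I)
    then obtain \<phi> L where \<phi>: "strict_mono \<phi>" "\<forall>i\<in>I. (\<lambda>m. u (\<phi> m) i) \<longlonglongrightarrow> L i"
      by auto
    have "\<forall>m. u (\<phi> m) k \<in> {lo..hi}"
      using insert.prems by blast
    then obtain l \<psi> where \<psi>: "strict_mono \<psi>" "((\<lambda>m. u (\<phi> m) k) \<circ> \<psi>) \<longlonglongrightarrow> l"
      using compact_imp_seq_compact[OF compact_Icc[of lo hi]] unfolding seq_compact_def by metis
    have "\<forall>i\<in>I. (\<lambda>m. u ((\<phi> \<circ> \<psi>) m) i) \<longlonglongrightarrow> L i"
    proof
      fix i assume "i \<in> I"
      from LIMSEQ_subseq_LIMSEQ[OF \<phi>(2)[rule_format, OF this] \<psi>(1)]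
      show "(\<lambda>m. u ((\<phi> \<circ> \<psi>) m) i) \<longlonglongrightarrow> L i" by (simp add: o_def)
    qed
    then have "\<forall>i\<in>insert k I. (\<lambda>m. u ((\<phi> \<circ> \<psi>) m) i) \<longlonglongrightarrow> (L(k := l)) i"
      using \<psi>(2) insert.hyps(2) by (auto simp: o_def)
    then show ?case using strict_mono_o[OF \<phi>(1) \<psi>(1)] by blast
  qed
  then show ?thesis using that by blast
qed

text \<open>A fixed point of \<open>x + f x\<close> clamped to the cube works: where
  \<open>f x i\<close> is nonzero the clamp must be active, so \<open>x i\<close> is
  \<open>R\<close> or \<open>- R\<close> with the sign of \<open>f x i\<close>. It arises as a limit
  of the cells that Kuhn's lemma provides on finer and finer grids.\<close>

lemma cube_variational_inequality:
  fixes f :: "('i \<Rightarrow> real) \<Rightarrow> 'i \<Rightarrow> real"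
  assumes I: "finite I" and R: "R > 0"
    and cont: "\<And>i. i \<in> I \<Longrightarrow> continuous_on UNIV (\<lambda>x. f x i)"
  obtains x where "\<And>i. i \<in> I \<Longrightarrow> f x i * x i = R * \<bar>f x i\<bar>"
proof -
  define g where "g x i = max (- R) (min R (x i + f x i)) - x i" for x i
  define n where "n = card I"
  obtain h where h: "bij_betw h I {..<n}"
    using I n_def by (metis atLeast0LessThan ex_bij_betw_finite_nat)
  \<comment> \<open>Grid points of mesh \<open>2 * R / p\<close>. The constant value outside
    \<open>I\<close> lets them converge in every coordinate, as continuity of \<open>f\<close> on
    the full function space demands.\<close>
  define pt where "pt p z = (\<lambda>i. if i \<in> I then - R + 2 * R * (real (z (h i)) / real p) else 0)"
    for p :: nat and z :: "nat \<Rightarrow> nat"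
  define hi where "hi = the_inv_into I h"
  have hi: "hi k \<in> I" "h (hi k) = k" if "k < n" for k
    using that h unfolding hi_def
    by (auto simp: bij_betw_def intro!: the_inv_into_into f_the_inv_into_f)
  have hlt: "h i < n" "hi (h i) = i" if "i \<in> I" for i
    using that h unfolding hi_def by (auto simp: bij_betw_def the_inv_into_f_f)
  have gcont: "continuous_on UNIV (\<lambda>x. g x i)" if "i \<in> I" for i
    unfolding g_def by (intro continuous_intros cont that continuous_on_product_coordinates)
  \<comment> \<open>The upper face always gets label 1. There the clamp makes \<open>g\<close> \<le>
    0, so label 0 implies \<open>g\<close> \<ge> 0 and label 1 implies \<open>g\<close> \<le> 0 at
    all grid points of the cube.\<close>
  define label where "label p z k = (if g (pt p z) (hi k) \<ge> 0 \<and> z k \<noteq> p then 0 else 1 :: nat)" for p z k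
  define good where "good p q r s \<longleftrightarrow> (\<forall>k<n. q k < p \<and>
      (\<forall>j<n. q j \<le> r k j \<and> r k j \<le> q j + 1 \<and> q j \<le> s k j \<and> s k j \<le> q j + 1) \<and>
      g (pt p (r k)) (hi k) \<ge> 0 \<and> g (pt p (s k)) (hi k) \<le> 0)" for p q r s
  have ex: "\<exists>q r s. good (Suc m) q r s" for m
  proof -
    let ?p = "Suc m"
    have low: "label ?p z k = 0" if "z k = 0" "k < n" for z k
      using that R hi by (auto simp: label_def g_def pt_def)
    have labels: "\<forall>z. (\<forall>i<n. z i \<le> ?p) \<longrightarrow> (\<forall>i<n. label ?p z i = 0 \<or> label ?p z i = 1)"
      "\<forall>z. (\<forall>i<n. z i \<le> ?p) \<longrightarrow> (\<forall>i<n. z i = 0 \<longrightarrow> label ?p z i = 0)"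
      "\<forall>z. (\<forall>i<n. z i \<le> ?p) \<longrightarrow> (\<forall>i<n. z i = ?p \<longrightarrow> label ?p z i = 1)"
      using low by (simp_all add: label_def)
    obtain q where q: "\<forall>i<n. q i < ?p"
      "\<forall>i<n. \<exists>r s. (\<forall>j<n. q j \<le> r j \<and> r j \<le> q j + 1) \<and> (\<forall>j<n. q j \<le> s j \<and> s j \<le> q j + 1)
          \<and> label ?p r i \<noteq> label ?p s i"
      using kuhn_lemma[OF zero_less_Suc labels] .
    have "\<exists>r s. (\<forall>j<n. q j \<le> r j \<and> r j \<le> q j + 1 \<and> q j \<le> s j \<and> s j \<le> q j + 1) \<and>
      g (pt ?p r) (hi k) \<ge> 0 \<and> g (pt ?p s) (hi k) \<le> 0" if "k < n" for k
    proof -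
      obtain r s where rs: "\<forall>j<n. q j \<le> r j \<and> r j \<le> q j + 1" "\<forall>j<n. q j \<le> s j \<and> s j \<le> q j + 1"
        "label ?p r k \<noteq> label ?p s k"
        using q(2) \<open>k < n\<close> by blast
      have l0: "g (pt ?p z) (hi k) \<ge> 0" if "label ?p z k = 0" for z
        using that by (auto simp: label_def split: if_splits)
      have l1: "g (pt ?p z) (hi k) \<le> 0" if "label ?p z k \<noteq> 0" for z
      proof (cases "z k = ?p")
        case True
        then show ?thesis using R hi \<open>k < n\<close> by (auto simp: g_def pt_def)
      next
        case False
        then show ?thesis using that by (auto simp: label_def split: if_splits)
      qed
      show ?thesis
      proof (cases "label ?p r k = 0")
        case True
        then have "label ?p s k \<noteq> 0" using rs(3) by simp
        with True rs l0 l1 show ?thesis by blast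
      next
        case False
        then have "label ?p s k = 0" using rs(3) by (auto simp: label_def split: if_splits)
        with False rs l0 l1 show ?thesis by blast
      qed
    qed
    then have "\<exists>r s. \<forall>k<n. (\<forall>j<n. q j \<le> r k j \<and> r k j \<le> q j + 1 \<and> q j \<le> s k j \<and> s k j \<le> q j + 1) \<and>
      g (pt ?p (r k)) (hi k) \<ge> 0 \<and> g (pt ?p (s k)) (hi k) \<le> 0"
      by metis
    then obtain r s where "\<forall>k<n. (\<forall>j<n. q j \<le> r k j \<and> r k j \<le> q j + 1 \<and> q j \<le> s k j \<and> s k j \<le> q j + 1) \<and>
      g (pt ?p (r k)) (hi k) \<ge> 0 \<and> g (pt ?p (s k)) (hi k) \<le> 0"
      by blast
    then have "good ?p q r s" using q(1) by (simp add: good_def)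
    then show ?thesis by blast
  qed
  obtain q r s where good: "\<And>m. good (Suc m) (q m) (r m) (s m)"
    using ex by metis
  define u where "u m k = real (q m k) / real (Suc m)" for m k
  have "u m k \<in> {0..1}" if "k \<in> {..<n}" for m k
    using good[of m] that unfolding good_def u_def by (force simp: divide_simps)
  then obtain \<phi> L where \<phi>: "strict_mono \<phi>" and L: "\<And>k. k \<in> {..<n} \<Longrightarrow> (\<lambda>m. u (\<phi> m) k) \<longlonglongrightarrow> L k"
    using bounded_finite_convergent_subseq[of "{..<n}" u 0 1] by blast
  have inv0: "(\<lambda>m. 1 / real (Suc (\<phi> m))) \<longlonglongrightarrow> 0"
    using LIMSEQ_subseq_LIMSEQ[OF lim_inverse_n'[THEN LIMSEQ_Suc] \<phi>] by (simp add: o_def)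
  define x where "x = (\<lambda>i. if i \<in> I then - R + 2 * R * L (h i) else 0)"
  \<comment> \<open>The vertices witnessing the two signs differ with \<open>k\<close>, but the
    cells shrink, so all of them tend to the same \<open>x\<close>.\<close>
  have ptlim: "(\<lambda>m. pt (Suc (\<phi> m)) (w (\<phi> m))) \<longlonglongrightarrow> x"
    if w: "\<And>m j. j < n \<Longrightarrow> q m j \<le> w m j \<and> w m j \<le> q m j + 1" for w
  proof -
    have "(\<lambda>m. pt (Suc (\<phi> m)) (w (\<phi> m)) i) \<longlonglongrightarrow> x i" for i
    proof (cases "i \<in> I")
      case True
      have "(\<lambda>m. real (w (\<phi> m) (h i)) / real (Suc (\<phi> m))) \<longlonglongrightarrow> L (h i)"
      proof (rule tendsto_sandwich)
        have hin: "h i < n" using hlt True by blast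
        show "\<forall>\<^sub>F m in sequentially. u (\<phi> m) (h i) \<le> real (w (\<phi> m) (h i)) / real (Suc (\<phi> m))"
          using w[OF hin] unfolding u_def by (intro always_eventually allI divide_right_mono) auto
        have "real (w (\<phi> m) (h i)) \<le> real (q (\<phi> m) (h i)) + 1" for m
          using w[OF hin, of "\<phi> m"] by linarith
        then show "\<forall>\<^sub>F m in sequentially. real (w (\<phi> m) (h i)) / real (Suc (\<phi> m)) \<le> u (\<phi> m) (h i) + 1 / real (Suc (\<phi> m))"
          unfolding u_def add_divide_distrib[symmetric]
          by (intro always_eventually allI divide_right_mono) auto
        show "(\<lambda>m. u (\<phi> m) (h i)) \<longlonglongrightarrow> L (h i)"
          using L hin by auto
        show "(\<lambda>m. u (\<phi> m) (h i) + 1 / real (Suc (\<phi> m))) \<longlonglongrightarrow> L (h i)"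
          using tendsto_add[OF L inv0] hin by auto
      qed
      then have "(\<lambda>m. - R + 2 * R * (real (w (\<phi> m) (h i)) / real (Suc (\<phi> m)))) \<longlonglongrightarrow> - R + 2 * R * L (h i)"
        by (intro tendsto_intros)
      then show ?thesis using True by (simp only: pt_def x_def if_True)
    next
      case False
      then show ?thesis by (simp add: pt_def x_def)
    qed
    then show ?thesis by (simp add: tendsto_fun_iff)
  qed
  have "g x i = 0" if "i \<in> I" for i
  proof (rule antisym)
    let ?k = "h i"
    have k: "?k < n" "hi ?k = i" using hlt that by auto
    have sign: "0 \<le> g (pt (Suc m) (r m ?k)) i" "g (pt (Suc m) (s m ?k)) i \<le> 0" for m
      using good[of m] k unfolding good_def by auto
    have "(\<lambda>m. g (pt (Suc (\<phi> m)) (r (\<phi> m) ?k)) i) \<longlonglongrightarrow> g x i"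
      by (rule continuous_on_tendsto_compose[OF gcont[OF that] ptlim[where w = "\<lambda>m. r m ?k"]])
        (use good k in \<open>auto simp: good_def\<close>)
    then show "0 \<le> g x i"
      by (rule LIMSEQ_le_const) (use sign(1) in blast)
    have "(\<lambda>m. g (pt (Suc (\<phi> m)) (s (\<phi> m) ?k)) i) \<longlonglongrightarrow> g x i"
      by (rule continuous_on_tendsto_compose[OF gcont[OF that] ptlim[where w = "\<lambda>m. s m ?k"]])
        (use good k in \<open>auto simp: good_def\<close>)
    then show "g x i \<le> 0"
      by (rule LIMSEQ_le_const2) (use sign(2) in blast)
  qed
  moreover have "f x i * x i = R * \<bar>f x i\<bar>" if "g x i = 0" for i
  proof -
    have *: "max (- R) (min R (x i + f x i)) = x i"
      using that by (simp add: g_def)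
    consider "f x i = 0" | "f x i > 0" | "f x i < 0" by linarith
    then show ?thesis
    proof cases
      case 2
      then have "x i = R" using * R by linarith
      then show ?thesis using 2 by simp
    next
      case 3
      then have "x i = - R" using * R by linarith
      then show ?thesis using 3 by simp
    qed simp
  qed
  ultimately show ?thesis using that by blast
qed

section \<open>Limits of approximately feasible linear systems\<close>

text \<open>No compactness is available here, as the approximate solutions may be unbounded. Farkas'
  lemma helps: infeasibility puts \<open>(0, -1)\<close> into a finitely generated, hence closed, cone.\<close>

lemma affine_system_limit_feasible:
  fixes a :: "'i \<Rightarrow> 'a::euclidean_space" and b :: "'i \<Rightarrow> real"
  assumes I: "finite I"
    and approx: "\<And>\<delta>. \<delta> > 0 \<Longrightarrow> \<exists>q. \<forall>i\<in>I. a i \<bullet> q \<le> b i + \<delta>"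
  shows "\<exists>q. \<forall>i\<in>I. a i \<bullet> q \<le> b i"
proof -
  obtain q where q: "\<And>\<delta> i. \<delta> > 0 \<Longrightarrow> i \<in> I \<Longrightarrow> a i \<bullet> q \<delta> \<le> b i + \<delta>"
    using approx by metis
  \<comment> \<open>A pair \<open>(v, c)\<close> encodes the inequality
    \<open>v \<bullet> q \<le> c\<close>. The cone \<open>C\<close> collects consequences of the
    system; \<open>(0, 1)\<close> is the trivial inequality and \<open>(0, -1)\<close> the
    contradiction.\<close>
  define S where "S = insert (0, 1) ((\<lambda>i. (a i, b i)) ` I)"
  define C where "C = convex_cone hull S"
  have cone: "convex_cone C"
    unfolding C_def by (rule convex_cone_convex_cone_hull)
  have SC: "S \<subseteq> C" unfolding C_def by (rule hull_subset)
  \<comment> \<open>The inequalities that \<open>q \<delta>\<close> satisfies up to an error linear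
    in \<open>\<delta>\<close>. They form a cone that contains the generators but, as small
    \<open>\<delta>\<close> shows, not the contradiction.\<close>
  define T where "T = {z. \<exists>M. \<forall>\<delta>>0. snd z \<ge> fst z \<bullet> q \<delta> - M * \<delta>}"
  have "convex_cone T"
    unfolding convex_cone_iff
  proof (intro conjI ballI allI impI)
    show "0 \<in> T" by (auto simp: T_def intro: exI[of _ 0])
  next
    fix y z assume "y \<in> T" "z \<in> T"
    then obtain M N where "\<forall>\<delta>>0. snd y \<ge> fst y \<bullet> q \<delta> - M * \<delta>" "\<forall>\<delta>>0. snd z \<ge> fst z \<bullet> q \<delta> - N * \<delta>"
      by (auto simp: T_def)
    then have "\<forall>\<delta>>0. snd (y + z) \<ge> fst (y + z) \<bullet> q \<delta> - (M + N) * \<delta>"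
      by (fastforce simp: algebra_simps)
    then show "y + z \<in> T" by (auto simp: T_def)
  next
    fix y and c :: real assume "y \<in> T" "0 \<le> c"
    then obtain M where M: "\<forall>\<delta>>0. snd y \<ge> fst y \<bullet> q \<delta> - M * \<delta>"
      by (auto simp: T_def)
    have "snd (c *\<^sub>R y) \<ge> fst (c *\<^sub>R y) \<bullet> q \<delta> - (c * M) * \<delta>" if "\<delta> > 0" for \<delta>
      using mult_left_mono[OF M[rule_format, OF that] \<open>0 \<le> c\<close>] by (simp add: algebra_simps)
    then show "c *\<^sub>R y \<in> T" by (auto simp: T_def)
  qed
  moreover have "S \<subseteq> T"
  proof -
    have "(0, 1) \<in> T" by (auto simp: T_def intro: exI[of _ 0])
    moreover have "(a i, b i) \<in> T" if "i \<in> I" for i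
      using q[OF _ that] by (auto simp: T_def algebra_simps intro!: exI[of _ 1])
    ultimately show ?thesis by (auto simp: S_def)
  qed
  ultimately have "C \<subseteq> T"
    unfolding C_def by (simp add: hull_minimal)
  moreover have "(0, -1) \<notin> T"
  proof
    assume "(0, -1) \<in> T"
    then obtain M where M: "\<forall>\<delta>>0. - (1 :: real) \<ge> - M * \<delta>" by (auto simp: T_def)
    have pos: "\<bar>M\<bar> + 1 > 0" by simp
    then have "M * (1 / (\<bar>M\<bar> + 1)) < 1" by (simp add: pos_divide_less_eq)
    moreover have "- 1 \<ge> - M * (1 / (\<bar>M\<bar> + 1))" by (rule M[rule_format]) (use pos in simp)
    ultimately show False by simp
  qed
  ultimately have notin: "(0, -1) \<notin> C" by blast
  have "closed C" unfolding C_def S_def using I by (intro closed_convex_cone_hull) auto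
  then obtain w \<beta> where w: "w \<bullet> (0, -1) < \<beta>" "\<And>x. x \<in> C \<Longrightarrow> w \<bullet> x > \<beta>"
    using separating_hyperplane_closed_point[OF _ _ notin] cone unfolding convex_cone_def by blast
  have "\<beta> < 0" using w(2)[of 0] cone by (simp add: convex_cone_iff)
  \<comment> \<open>A functional bounded below on a cone is nonnegative there, since a negative
    value could be scaled to equal the bound \<open>\<beta>\<close>.\<close>
  have nn: "w \<bullet> x \<ge> 0" if "x \<in> C" for x
  proof (rule ccontr)
    assume neg: "\<not> w \<bullet> x \<ge> 0"
    have "(\<beta> / (w \<bullet> x)) *\<^sub>R x \<in> C"
      using cone that neg \<open>\<beta> < 0\<close> by (auto simp: convex_cone_iff divide_nonpos_neg)
    from w(2)[OF this] neg show False by simp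
  qed
  obtain v \<tau> where vt: "w = (v, \<tau>)" by fastforce
  have "(0, 1) \<in> C" using SC by (auto simp: S_def)
  have "\<tau> > 0"
  proof -
    have "\<tau> \<ge> 0" using nn[OF \<open>(0, 1) \<in> C\<close>] vt by simp
    moreover have "\<tau> \<noteq> 0" using w(1) \<open>\<beta> < 0\<close> vt by auto
    ultimately show ?thesis by simp
  qed
  have "a i \<bullet> ((- 1 / \<tau>) *\<^sub>R v) \<le> b i" if "i \<in> I" for i
  proof -
    have "(a i, b i) \<in> C" using SC that by (auto simp: S_def)
    from nn[OF this] vt \<open>\<tau> > 0\<close> show ?thesis by (simp add: field_simps inner_commute)
  qed
  then show ?thesis by blast
qed

section \<open>Colourful Caratheodory through cubes in the dual space\<close>

section \<open>Colourful zeros\<close>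

lemma continuous_on_sin_coordinate:
  "continuous_on UNIV (\<lambda>x :: 'l \<Rightarrow> real. sin (pi * (x l - \<alpha>)))"
  by (rule continuous_on_compose2[of UNIV "\<lambda>y. sin (pi * (y - \<alpha>))"])
    (auto intro!: continuous_intros continuous_on_product_coordinates)

text \<open>The function \<open>g\<close> of the cell jumps only at the walls of the grid shifted by
  \<open>\<alpha>\<close>. There the squared sines vanish and the bound on \<open>g\<close> forces
  the limit 0; off the walls the cell is locally constant. The map \<open>e\<close> allows further
  coordinates that the grid ignores.\<close>

lemma continuous_on_cellwise:
  fixes g :: "('k \<Rightarrow> int) \<Rightarrow> real" and e :: "'k \<Rightarrow> 'l"
  assumes K: "finite K" and bound: "\<And>z. \<bar>g z\<bar> \<le> B"
  shows "continuous_on UNIV (\<lambda>x :: 'l \<Rightarrow> real.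
    (\<Prod>k\<in>K. (sin (pi * (x (e k) - \<alpha>)))\<^sup>2) * g (\<lambda>k. if k \<in> K then \<lfloor>x (e k) - \<alpha>\<rfloor> else 0))"
    (is "continuous_on UNIV (\<lambda>x. ?W x * g (?cell x))")
  unfolding continuous_on_def
proof
  fix x0 :: "'l \<Rightarrow> real"
  have coord: "((\<lambda>x. x (e k) - \<alpha>) \<longlongrightarrow> x0 (e k) - \<alpha>) (at x0 within UNIV)" for k
  proof -
    have "continuous_on UNIV (\<lambda>x :: 'l \<Rightarrow> real. x (e k) - \<alpha>)"
      by (intro continuous_intros continuous_on_product_coordinates)
    then show ?thesis unfolding continuous_on_def by blast
  qed
  have W: "(?W \<longlongrightarrow> ?W x0) (at x0 within UNIV)"
    by (intro tendsto_intros
        continuous_on_sin_coordinate[unfolded continuous_on_def, rule_format]) auto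
  show "((\<lambda>x. ?W x * g (?cell x)) \<longlongrightarrow> ?W x0 * g (?cell x0)) (at x0 within UNIV)"
  proof (cases "\<exists>k\<in>K. x0 (e k) - \<alpha> \<in> \<int>")
    case True
    then obtain k where k: "k \<in> K" "x0 (e k) - \<alpha> \<in> \<int>" by blast
    then have "sin (pi * (x0 (e k) - \<alpha>)) = 0"
      by (metis Ints_cases mult.commute sin_npi_int)
    then have W0: "?W x0 = 0" using k K by (intro prod_zero) auto
    have "((\<lambda>x. \<bar>?W x\<bar> * B) \<longlongrightarrow> \<bar>?W x0\<bar> * B) (at x0 within UNIV)"
      by (intro tendsto_intros W)
    then have lim0: "((\<lambda>x. \<bar>?W x\<bar> * B) \<longlongrightarrow> 0) (at x0 within UNIV)"
      using W0 by simp
    have le: "norm (?W x * g (?cell x)) \<le> \<bar>?W x\<bar> * B" for x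
      using bound by (simp add: abs_mult mult_left_mono)
    have "((\<lambda>x. ?W x * g (?cell x)) \<longlongrightarrow> 0) (at x0 within UNIV)"
      by (rule Lim_null_comparison[OF always_eventually[OF allI[OF le]] lim0])
    then show ?thesis using W0 by simp
  next
    case False
    have "\<forall>\<^sub>F x in at x0 within UNIV. \<lfloor>x (e k) - \<alpha>\<rfloor> = \<lfloor>x0 (e k) - \<alpha>\<rfloor>" if "k \<in> K" for k
    proof -
      let ?z = "\<lfloor>x0 (e k) - \<alpha>\<rfloor>"
      have "of_int ?z \<noteq> x0 (e k) - \<alpha>" using False that by (metis Ints_of_int)
      then have "of_int ?z < x0 (e k) - \<alpha>" by linarith
      from order_tendstoD(1)[OF coord this]
      have "\<forall>\<^sub>F x in at x0 within UNIV. of_int ?z < x (e k) - \<alpha>" .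
      moreover have "\<forall>\<^sub>F x in at x0 within UNIV. x (e k) - \<alpha> < of_int ?z + 1"
        by (rule order_tendstoD(2)[OF coord]) linarith
      ultimately show ?thesis
        by eventually_elim (simp add: floor_unique)
    qed
    then have "\<forall>\<^sub>F x in at x0 within UNIV. \<forall>k\<in>K. \<lfloor>x (e k) - \<alpha>\<rfloor> = \<lfloor>x0 (e k) - \<alpha>\<rfloor>"
      by (intro eventually_ball_finite K) blast
    then have "\<forall>\<^sub>F x in at x0 within UNIV. ?W x * g (?cell x0) = ?W x * g (?cell x)"
    proof eventually_elim
      case (elim x)
      then have "?cell x = ?cell x0" by auto
      then show ?case by simp
    qed
    moreover have "((\<lambda>x. ?W x * g (?cell x0)) \<longlongrightarrow> ?W x0 * g (?cell x0)) (at x0 within UNIV)"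
      by (intro tendsto_intros W)
    ultimately show ?thesis by (rule Lim_transform_eventually[rotated])
  qed
qed

text \<open>A coordinate of \<open>x\<close> lies on a cell wall for at most one of the shifted grids, so
  \<open>card K\<close> coordinates cannot spoil all \<open>card K + 1\<close> grids.\<close>

lemma colour_weights_pos:
  fixes x :: "'k \<Rightarrow> real"
  assumes K: "finite K"
  shows "(\<Sum>i\<le>card K. \<Prod>k\<in>K. (sin (pi * (x k - real i / real (Suc (card K)))))\<^sup>2) > 0"
proof -
  define \<alpha> where "\<alpha> i = real i / real (Suc (card K))" for i
  define kill where "kill k = {i. i \<le> card K \<and> x k - \<alpha> i \<in> \<int>}" for k
  have "card (kill k) \<le> 1" for k
  proof -
    have "i = j" if "i \<in> kill k" "j \<in> kill k" for i j
    proof -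
      have "x k - \<alpha> i \<in> \<int>" "x k - \<alpha> j \<in> \<int>" using that by (simp_all add: kill_def)
      then have "(x k - \<alpha> i) - (x k - \<alpha> j) \<in> \<int>" by (rule Ints_diff)
      then obtain z where z: "\<alpha> j - \<alpha> i = of_int z" by (auto elim: Ints_cases)
      \<comment> \<open>The shifts lie in [0, 1), so two of them differ by an integer only if they
        are equal.\<close>
      moreover have "\<bar>\<alpha> j - \<alpha> i\<bar> < 1"
        using that unfolding \<alpha>_def kill_def diff_divide_distrib[symmetric]
        by (auto simp: abs_if divide_simps)
      ultimately have "real_of_int \<bar>z\<bar> < 1" by simp
      then have "z = 0" unfolding of_int_less_1_iff by simp
      then have "\<alpha> j = \<alpha> i" using z by simp
      then show ?thesis by (simp add: \<alpha>_def field_simps del: of_nat_Suc)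
    qed
    then show ?thesis by (simp add: card_le_Suc0_iff_eq kill_def)
  qed
  then have "card (\<Union>k\<in>K. kill k) \<le> card K"
    using card_UN_le[OF K, of kill] sum_bounded_above[of K "\<lambda>k. card (kill k)" 1] by fastforce
  then have "\<not> {..card K} \<subseteq> (\<Union>k\<in>K. kill k)"
    using card_mono[of "\<Union>k\<in>K. kill k" "{..card K}"] K by (fastforce simp: kill_def)
  then obtain i where i: "i \<le> card K" "\<And>k. k \<in> K \<Longrightarrow> x k - \<alpha> i \<notin> \<int>"
    by (auto simp: kill_def)
  have "sin (pi * (x k - \<alpha> i)) \<noteq> 0" if "k \<in> K" for k
  proof
    assume "sin (pi * (x k - \<alpha> i)) = 0"
    then obtain n where "pi * (x k - \<alpha> i) = of_int n * pi" by (auto simp: sin_zero_iff_int2)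
    then have "x k - \<alpha> i = of_int n" by simp
    then show False using i(2)[OF that] by simp
  qed
  then have "(\<Prod>k\<in>K. (sin (pi * (x k - \<alpha> i)))\<^sup>2) > 0"
    by (intro prod_pos) simp
  then show ?thesis
    unfolding \<alpha>_def[symmetric] using i(1) by (intro sum_pos2[of _ i]) (auto intro: prod_nonneg)
qed

text \<open>The index \<open>i\<close> is a colour; the flag tells on which side of hyperplane \<open>i\<close> the point lies,
  and \<open>p i\<close>, \<open>m i\<close> are the weights of the vectors chosen for the two sides.\<close>

lemma colourful_approximate_solution:
  fixes c :: "nat \<Rightarrow> bool \<Rightarrow> 'j \<Rightarrow> 'k \<Rightarrow> real" and a :: "nat \<Rightarrow> 'a::euclidean_space"
    and b :: "nat \<Rightarrow> real"
  assumes K: "finite K" and J: "finite J"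
    and half: "\<And>i s X. i \<le> card K \<Longrightarrow> \<exists>j\<in>J. (\<Sum>k\<in>K. c i s j k * X k) \<le> 0"
    and R: "R > 0" and \<delta>: "\<delta> > 0"
  defines "B \<equiv> (\<Sum>i\<le>card K. \<Sum>s\<in>UNIV. \<Sum>j\<in>J. \<Sum>k\<in>K. \<bar>c i s j k\<bar>) + (\<Sum>i\<le>card K. \<bar>b i\<bar>)"
  shows "\<exists>q p m jp jm. (\<forall>i\<le>card K. p i \<ge> 0 \<and> m i \<ge> 0 \<and> jp i \<in> J \<and> jm i \<in> J \<and>
        (b i - a i \<bullet> q \<ge> \<delta> \<longrightarrow> m i = 0) \<and> (b i - a i \<bullet> q \<le> - \<delta> \<longrightarrow> p i = 0)) \<and>
      (\<Sum>i\<le>card K. p i + m i) = 1 \<and>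
      (\<forall>k\<in>K. \<bar>\<Sum>i\<le>card K. p i * c i True (jp i) k + m i * c i False (jm i) k\<bar> \<le> B / R) \<and>
      (\<forall>e\<in>Basis. \<bar>\<Sum>i\<le>card K. (p i - m i) * (a i \<bullet> e)\<bar> \<le> B / R)"
proof -
  let ?N = "card K"
  define C where "C = (\<Sum>i\<le>?N. \<Sum>s\<in>UNIV. \<Sum>j\<in>J. \<Sum>k\<in>K. \<bar>c i s j k\<bar>)"
  define D where "D = (\<Sum>i\<le>?N. \<bar>b i\<bar>)"
  have BCD: "B = C + D" by (simp add: B_def C_def D_def)
  have C: "(\<Sum>k\<in>K. \<bar>c i s j k\<bar>) \<le> C" if "i \<le> ?N" "j \<in> J" for i s j
  proof -
    have "(\<Sum>k\<in>K. \<bar>c i s j k\<bar>) \<le> (\<Sum>j\<in>J. \<Sum>k\<in>K. \<bar>c i s j k\<bar>)"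
      using J that by (intro member_le_sum) (auto intro: sum_nonneg)
    also have "\<dots> \<le> (\<Sum>s\<in>UNIV. \<Sum>j\<in>J. \<Sum>k\<in>K. \<bar>c i s j k\<bar>)"
      by (intro member_le_sum[where f = "\<lambda>s. \<Sum>j\<in>J. \<Sum>k\<in>K. \<bar>c i s j k\<bar>"]) (auto intro!: sum_nonneg)
    also have "\<dots> \<le> C"
      unfolding C_def using that
      by (intro member_le_sum[where f = "\<lambda>i. \<Sum>s\<in>UNIV. \<Sum>j\<in>J. \<Sum>k\<in>K. \<bar>c i s j k\<bar>"])
        (auto intro!: sum_nonneg)
    finally show ?thesis .
  qed
  have Ck: "\<bar>c i s j k\<bar> \<le> C" if "i \<le> ?N" "j \<in> J" "k \<in> K" for i s j k
    using C[OF that(1,2), of s] member_le_sum[of k K "\<lambda>k. \<bar>c i s j k\<bar>"] that(3) K by fastforce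
  have D: "\<bar>b i\<bar> \<le> D" if "i \<le> ?N" for i
    unfolding D_def using that by (intro member_le_sum) auto
  \<comment> \<open>The choice for colour \<open>i\<close> and side \<open>s\<close> when the dual
    vector is \<open>X\<close>.\<close>
  obtain ch where ch: "\<And>i s X. i \<le> ?N \<Longrightarrow> ch i s X \<in> J \<and> (\<Sum>k\<in>K. c i s (ch i s X) k * X k) \<le> 0"
    using half by metis
  define \<alpha> where "\<alpha> i = real i / real (Suc ?N)" for i
  \<comment> \<open>Coordinates \<open>Inl k\<close> form the dual vector and coordinates
    \<open>Inr e\<close> the point \<open>q\<close>. The grids see only the former, so no extra
    colours are needed for \<open>q\<close>.\<close>
  define w where "w i x = (\<Prod>k\<in>K. (sin (pi * (x (Inl k) - \<alpha> i)))\<^sup>2)" for i and x :: "'k + 'a \<Rightarrow> real"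
  \<comment> \<open>The lower corner of a cell. Choosing at this corner makes the choice constant on
    the cell and independent of \<open>q\<close>.\<close>
  define rep where "rep i z k = of_int (z k) + \<alpha> i" for i and z :: "'k \<Rightarrow> int" and k
  define cell where "cell i x = (\<lambda>k. if k \<in> K then \<lfloor>x (Inl k) - \<alpha> i\<rfloor> else 0)" for i and x :: "'k + 'a \<Rightarrow> real"
  define jx where "jx i s x = ch i s (rep i (cell i x))" for i s x
  define pt where "pt x = (\<Sum>e\<in>Basis. x (Inr e) *\<^sub>R e)" for x :: "'k + 'a \<Rightarrow> real"
  \<comment> \<open>a continuous substitute for the sign of \<open>b i - a i \<bullet> q\<close>\<close>
  define t where "t i x = max (-1) (min 1 ((b i - a i \<bullet> pt x) / \<delta>))" for i x
  \<comment> \<open>The first block mixes the vectors chosen for the two sides in the ratio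
    \<open>1 + t\<close> to \<open>1 - t\<close>. The second block moves \<open>q\<close> by the
    signed normals, so that their total becomes small as well.\<close>
  define F where "F x l = (case l of
      Inl k \<Rightarrow> \<Sum>i\<le>?N. (1 + t i x) / 2 * (w i x * c i True (jx i True x) k)
                  + (1 - t i x) / 2 * (w i x * c i False (jx i False x) k)
    | Inr e \<Rightarrow> \<Sum>i\<le>?N. w i x * t i x * (a i \<bullet> e))" for x l
  define I where "I = Inl ` K \<union> Inr ` (Basis :: 'a set)"
  have jxJ: "jx i s x \<in> J" if "i \<le> ?N" for i s x
    using ch[OF that] by (simp add: jx_def)
  have wcont: "continuous_on UNIV (w i)" for i
    unfolding w_def[abs_def] by (intro continuous_intros continuous_on_sin_coordinate)
  have tcont: "continuous_on UNIV (t i)" for i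
    unfolding t_def[abs_def] pt_def[abs_def]
    by (intro continuous_intros continuous_on_product_coordinates) (use \<delta> in auto)
  have wc: "continuous_on UNIV (\<lambda>x. w i x * c i s (jx i s x) k)" if "i \<le> ?N" "k \<in> K" for i s k
    unfolding w_def cell_def jx_def
    by (rule continuous_on_cellwise[OF K, where B = C and e = Inl and
          g = "\<lambda>z. c i s (ch i s (rep i z)) k" and \<alpha> = "\<alpha> i"])
      (use Ck ch that in blast)
  have Fcont: "continuous_on UNIV (\<lambda>x. F x l)" if "l \<in> I" for l
  proof (cases l)
    case (Inl k)
    then have "k \<in> K" using that by (auto simp: I_def)
    then show ?thesis
      unfolding F_def Inl sum.case by (intro continuous_intros wc tcont) auto
  next
    case (Inr e)
    show ?thesis unfolding F_def Inr sum.case by (intro continuous_intros wcont tcont)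
  qed
  have finI: "finite I" using K by (simp add: I_def)
  obtain x where x: "\<And>l. l \<in> I \<Longrightarrow> F x l * x l = R * \<bar>F x l\<bar>"
    using cube_variational_inequality[OF finI R, of F] Fcont by blast
  define W where "W = (\<Sum>i\<le>?N. w i x)"
  have Wpos: "W > 0"
    unfolding W_def w_def \<alpha>_def using colour_weights_pos[OF K, of "\<lambda>k. x (Inl k)"] by simp
  have w0: "w i x \<ge> 0" for i unfolding w_def by (intro prod_nonneg) auto
  have t1: "- 1 \<le> t i x" "t i x \<le> 1" for i by (auto simp: t_def)
  have t2: "0 \<le> 1 + t i x" "0 \<le> 1 - t i x" for i using t1[of i] by auto
  \<comment> \<open>The choice is good at the corner of the cell, not at \<open>x\<close>; as each
    coordinate differs by at most 1, the error is bounded independently of \<open>R\<close>.\<close>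
  have cx: "(\<Sum>k\<in>K. c i s (jx i s x) k * x (Inl k)) \<le> C" if i: "i \<le> ?N" for i s
  proof -
    let ?X = "rep i (cell i x)"
    have "c i s (jx i s x) k * x (Inl k) \<le> c i s (jx i s x) k * ?X k + \<bar>c i s (jx i s x) k\<bar>" if "k \<in> K" for k
    proof -
      have "\<bar>x (Inl k) - ?X k\<bar> \<le> 1" using that by (simp add: rep_def cell_def) linarith
      then have "\<bar>c i s (jx i s x) k\<bar> * \<bar>x (Inl k) - ?X k\<bar> \<le> \<bar>c i s (jx i s x) k\<bar>"
        by (simp add: mult_left_le)
      then have "c i s (jx i s x) k * (x (Inl k) - ?X k) \<le> \<bar>c i s (jx i s x) k\<bar>"
        by (metis abs_le_D1 abs_mult)
      then show ?thesis by (simp add: algebra_simps)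
    qed
    then have "(\<Sum>k\<in>K. c i s (jx i s x) k * x (Inl k))
        \<le> (\<Sum>k\<in>K. c i s (jx i s x) k * ?X k) + (\<Sum>k\<in>K. \<bar>c i s (jx i s x) k\<bar>)"
      unfolding sum.distrib[symmetric] by (rule sum_mono)
    also have "\<dots> \<le> 0 + C"
      using ch[OF i, of s ?X] C[OF i jxJ[OF i], of s s x] by (intro add_mono) (auto simp: jx_def)
    finally show ?thesis by simp
  qed
  \<comment> \<open>Since \<open>t\<close> has the sign of \<open>b i - a i \<bullet> q\<close>, the
    motion of \<open>q\<close> points towards the hyperplane. This gives a bound that is uniform in
    \<open>q\<close>.\<close>
  have tq: "t i x * (a i \<bullet> pt x) \<le> D" if "i \<le> ?N" for i
  proof -
    let ?s = "b i - a i \<bullet> pt x"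
    have "t i x * ?s \<ge> 0"
      using \<delta> by (cases "?s \<ge> 0") (auto simp: t_def max_def min_def zero_le_mult_iff divide_simps)
    moreover have "t i x * b i \<le> \<bar>b i\<bar>"
    proof -
      have "\<bar>t i x\<bar> * \<bar>b i\<bar> \<le> 1 * \<bar>b i\<bar>" using t1[of i] by (intro mult_right_mono) auto
      then show ?thesis by (metis abs_le_D1 abs_mult mult_1)
    qed
    moreover have "t i x * (a i \<bullet> pt x) = t i x * b i - t i x * ?s" by (simp add: algebra_simps)
    ultimately show ?thesis using D[OF that] by linarith
  qed
  have "(\<Sum>k\<in>K. F x (Inl k) * x (Inl k)) = (\<Sum>i\<le>?N. w i x * ((1 + t i x) / 2 * (\<Sum>k\<in>K. c i True (jx i True x) k * x (Inl k))
                  + (1 - t i x) / 2 * (\<Sum>k\<in>K. c i False (jx i False x) k * x (Inl k))))"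
    unfolding F_def sum.case sum_distrib_left sum_distrib_right sum.distrib[symmetric]
    by (subst sum.swap) (simp add: algebra_simps)
  also have "\<dots> \<le> (\<Sum>i\<le>?N. w i x * ((1 + t i x) / 2 * C + (1 - t i x) / 2 * C))"
    using cx t2 w0 by (intro sum_mono mult_left_mono add_mono) auto
  also have "\<dots> = C * W"
    unfolding W_def sum_distrib_left by (intro sum.cong) (auto simp: field_simps)
  finally have le1: "(\<Sum>k\<in>K. F x (Inl k) * x (Inl k)) \<le> C * W" .
  have "(\<Sum>e\<in>Basis. F x (Inr e) * x (Inr e)) = (\<Sum>i\<le>?N. w i x * (t i x * (a i \<bullet> pt x)))"
    unfolding F_def sum.case sum_distrib_left sum_distrib_right pt_def inner_sum_right
    by (subst sum.swap) (simp add: algebra_simps)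
  also have "\<dots> \<le> (\<Sum>i\<le>?N. w i x * D)"
    using tq w0 by (intro sum_mono mult_left_mono) auto
  also have "\<dots> = D * W" by (simp add: W_def sum_distrib_left mult.commute)
  finally have le2: "(\<Sum>e\<in>Basis. F x (Inr e) * x (Inr e)) \<le> D * W" .
  \<comment> \<open>The pairing of \<open>F x\<close> with \<open>x\<close> is at most
    \<open>B * W\<close> with \<open>B\<close> free of \<open>R\<close>, while the variational
    inequality makes it \<open>R\<close> times the sum of the
    \<open>\<bar>F x l\<bar>\<close>.\<close>
  have "(\<Sum>l\<in>I. R * \<bar>F x l\<bar>) = (\<Sum>l\<in>I. F x l * x l)"
    using x by simp
  also have "\<dots> = (\<Sum>k\<in>K. F x (Inl k) * x (Inl k)) + (\<Sum>e\<in>Basis. F x (Inr e) * x (Inr e))"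
    unfolding I_def using K by (subst sum.union_disjoint) (auto simp: sum.reindex)
  also have "\<dots> \<le> B * W" using le1 le2 by (simp add: BCD algebra_simps)
  finally have tot: "(\<Sum>l\<in>I. R * \<bar>F x l\<bar>) \<le> B * W" .
  have Fl: "\<bar>F x l / W\<bar> \<le> B / R" if "l \<in> I" for l
  proof -
    have "R * \<bar>F x l\<bar> \<le> (\<Sum>l\<in>I. R * \<bar>F x l\<bar>)"
      using that finI R by (intro member_le_sum) auto
    with tot have "R * \<bar>F x l\<bar> \<le> B * W" by linarith
    then show ?thesis using R Wpos by (simp add: field_simps)
  qed
  define p where "p i = (1 + t i x) / 2 * w i x / W" for i
  define m where "m i = (1 - t i x) / 2 * w i x / W" for i
  have pm: "p i \<ge> 0" "m i \<ge> 0" for i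
    using t1[of i] w0[of i] Wpos by (simp_all add: p_def m_def)
  have m0: "m i = 0" if "b i - a i \<bullet> pt x \<ge> \<delta>" for i
    using that \<delta> by (simp add: m_def t_def min_def max_def field_simps)
  have p0: "p i = 0" if "b i - a i \<bullet> pt x \<le> - \<delta>" for i
  proof -
    have "(b i - a i \<bullet> pt x) / \<delta> \<le> -1" using that \<delta> by (simp add: field_simps)
    then have "t i x = -1" by (simp add: t_def)
    then show ?thesis by (simp add: p_def)
  qed
  have sum1: "(\<Sum>i\<le>?N. p i + m i) = 1"
  proof -
    have "(1 + t i x) / 2 * w i x + (1 - t i x) / 2 * w i x = w i x" for i
      by (simp add: field_simps)
    then have "p i + m i = w i x / W" for i
      unfolding p_def m_def add_divide_distrib[symmetric] by presburger
    then show ?thesis using Wpos by (simp add: sum_divide_distrib[symmetric] W_def[symmetric])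
  qed
  have Kb: "\<bar>\<Sum>i\<le>?N. p i * c i True (jx i True x) k + m i * c i False (jx i False x) k\<bar> \<le> B / R"
    if "k \<in> K" for k
  proof -
    have "(\<Sum>i\<le>?N. p i * c i True (jx i True x) k + m i * c i False (jx i False x) k) = F x (Inl k) / W"
      unfolding F_def sum.case sum_divide_distrib
      by (intro sum.cong) (simp_all add: p_def m_def add_divide_distrib)
    then show ?thesis using Fl[of "Inl k"] that by (simp add: I_def)
  qed
  have Bb: "\<bar>\<Sum>i\<le>?N. (p i - m i) * (a i \<bullet> e)\<bar> \<le> B / R" if "e \<in> Basis" for e
  proof -
    have "(1 + t i x) / 2 * w i x - (1 - t i x) / 2 * w i x = w i x * t i x" for i
      by (simp add: field_simps)
    then have "p i - m i = w i x * t i x / W" for i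
      unfolding p_def m_def diff_divide_distrib[symmetric] by presburger
    then have "(\<Sum>i\<le>?N. (p i - m i) * (a i \<bullet> e)) = F x (Inr e) / W"
      unfolding F_def sum.case sum_divide_distrib by (intro sum.cong) simp_all
    then show ?thesis using Fl[of "Inr e"] that by (simp add: I_def)
  qed
  show ?thesis
    by (intro exI[of _ "pt x"] exI[of _ p] exI[of _ m] exI[of _ "\<lambda>i. jx i True x"] exI[of _ "\<lambda>i. jx i False x"]
        conjI allI ballI impI) (simp_all only: pm m0 p0 sum1 jxJ Kb Bb)
qed

text \<open>The limit of approximate solutions with \<open>R\<close> tending to infinity and
  \<open>\<delta>\<close> to 0. The weights converge along a subsequence and the choices can be held
  fixed; the points may escape to infinity, so \<open>q\<close> comes instead from feasibility of
  the limiting sign conditions.\<close>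

lemma colourful_solution:
  fixes c :: "nat \<Rightarrow> bool \<Rightarrow> 'j \<Rightarrow> 'k \<Rightarrow> real" and a :: "nat \<Rightarrow> 'a::euclidean_space"
    and b :: "nat \<Rightarrow> real"
  assumes K: "finite K" and J: "finite J"
    and half: "\<And>i s X. i \<le> card K \<Longrightarrow> \<exists>j\<in>J. (\<Sum>k\<in>K. c i s j k * X k) \<le> 0"
  obtains q p m jp jm where
    "\<And>i. i \<le> card K \<Longrightarrow> p i \<ge> 0" "\<And>i. i \<le> card K \<Longrightarrow> m i \<ge> 0"
    "\<And>i. i \<le> card K \<Longrightarrow> jp i \<in> J" "\<And>i. i \<le> card K \<Longrightarrow> jm i \<in> J"
    "\<And>i. i \<le> card K \<Longrightarrow> b i - a i \<bullet> q > 0 \<Longrightarrow> m i = 0"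
    "\<And>i. i \<le> card K \<Longrightarrow> b i - a i \<bullet> q < 0 \<Longrightarrow> p i = 0"
    "(\<Sum>i\<le>card K. p i + m i) = 1"
    "\<And>k. k \<in> K \<Longrightarrow> (\<Sum>i\<le>card K. p i * c i True (jp i) k + m i * c i False (jm i) k) = 0"
    "(\<Sum>i\<le>card K. (p i - m i) *\<^sub>R a i) = 0"
proof -
  let ?N = "card K"
  define \<delta> where "\<delta> n = 1 / real (Suc n)" for n
  define s where "s q i = b i - a i \<bullet> q" for q i
  define B where "B = (\<Sum>i\<le>?N. \<Sum>s\<in>UNIV. \<Sum>j\<in>J. \<Sum>k\<in>K. \<bar>c i s j k\<bar>) + (\<Sum>i\<le>?N. \<bar>b i\<bar>)"
  define approx where "approx n q p m jp jm \<longleftrightarrow> (\<forall>i\<le>?N. p i \<ge> 0 \<and> m i \<ge> 0 \<and> jp i \<in> J \<and> jm i \<in> J \<and>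
        (s q i \<ge> \<delta> n \<longrightarrow> m i = 0) \<and> (s q i \<le> - \<delta> n \<longrightarrow> p i = 0)) \<and>
      (\<Sum>i\<le>?N. p i + m i) = 1 \<and>
      (\<forall>k\<in>K. \<bar>\<Sum>i\<le>?N. p i * c i True (jp i) k + m i * c i False (jm i) k\<bar> \<le> B / real (Suc n)) \<and>
      (\<forall>e\<in>Basis. \<bar>\<Sum>i\<le>?N. (p i - m i) * (a i \<bullet> e)\<bar> \<le> B / real (Suc n))"
    for n q p m jp jm
  have "\<exists>q p m jp jm. approx n q p m jp jm" for n
    unfolding approx_def s_def B_def
    by (rule colourful_approximate_solution[OF K J half]) (auto simp: \<delta>_def)
  then obtain q p m jp jm where "\<And>n. approx n (q n) (p n) (m n) (jp n) (jm n)"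
    by metis
  then have sol:
    "\<And>n i. i \<le> ?N \<Longrightarrow> p n i \<ge> 0 \<and> m n i \<ge> 0 \<and> jp n i \<in> J \<and> jm n i \<in> J"
    "\<And>n i. i \<le> ?N \<Longrightarrow> s (q n) i \<ge> \<delta> n \<Longrightarrow> m n i = 0"
    "\<And>n i. i \<le> ?N \<Longrightarrow> s (q n) i \<le> - \<delta> n \<Longrightarrow> p n i = 0"
    "\<And>n. (\<Sum>i\<le>?N. p n i + m n i) = 1"
    "\<And>n k. k \<in> K \<Longrightarrow> \<bar>\<Sum>i\<le>?N. p n i * c i True (jp n i) k + m n i * c i False (jm n i) k\<bar> \<le> B / real (Suc n)"
    "\<And>n e. e \<in> Basis \<Longrightarrow> \<bar>\<Sum>i\<le>?N. (p n i - m n i) * (a i \<bullet> e)\<bar> \<le> B / real (Suc n)"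
    unfolding approx_def by blast+
  \<comment> \<open>The sign of \<open>s (q n) i\<close> with a dead zone of width
    \<open>\<delta> n\<close>. Together with the two choices it takes finitely many values, so one
    pattern recurs infinitely often.\<close>
  define \<sigma> where "\<sigma> n i = (if s (q n) i \<ge> \<delta> n then 1 else if s (q n) i \<le> - \<delta> n then -1 else 0 :: real)" for n i
  define pat where "pat n = (restrict (jp n) {..?N}, restrict (jm n) {..?N}, restrict (\<sigma> n) {..?N})" for n
  have "pat n \<in> ({..?N} \<rightarrow>\<^sub>E J) \<times> ({..?N} \<rightarrow>\<^sub>E J) \<times> ({..?N} \<rightarrow>\<^sub>E {1, -1, 0})" for n
    using sol(1)[of _ n] by (simp add: pat_def PiE_iff \<sigma>_def)
  then have "range pat \<subseteq> ({..?N} \<rightarrow>\<^sub>E J) \<times> ({..?N} \<rightarrow>\<^sub>E J) \<times> ({..?N} \<rightarrow>\<^sub>E {1, -1, 0})"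
    by (rule image_subsetI)
  moreover have "finite (({..?N} \<rightarrow>\<^sub>E J) \<times> ({..?N} \<rightarrow>\<^sub>E J) \<times> ({..?N} \<rightarrow>\<^sub>E {1, -1, 0 :: real}))"
    using J by (intro finite_cartesian_product finite_PiE) auto
  ultimately have "finite (range pat)" by (rule finite_subset)
  from pigeonhole_infinite[OF infinite_UNIV_nat this]
  obtain n0 where inf: "infinite {n \<in> UNIV. pat n = pat n0}" by blast
  obtain \<phi>0 :: "nat \<Rightarrow> nat" where "strict_mono \<phi>0" "\<forall>n. \<phi>0 n \<in> {n \<in> UNIV. pat n = pat n0}"
    using infinite_enumerate[OF inf] by blast
  then have \<phi>0: "strict_mono \<phi>0" "pat (\<phi>0 n) = pat n0" for n
    by (simp_all del: Collect_const)
  have le1: "p n i \<le> 1 \<and> m n i \<le> 1" if "i \<le> ?N" for n i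
  proof -
    have "p n i + m n i \<le> (\<Sum>i\<le>?N. p n i + m n i)"
      using that sol(1) by (intro member_le_sum) (auto intro: add_nonneg_nonneg)
    then show ?thesis using sol(1)[OF that, of n] sol(4)[of n] by linarith
  qed
  define u where "u n l = (if snd l then p (\<phi>0 n) (fst l) else m (\<phi>0 n) (fst l))" for n l
  have ub: "u n l \<in> {0..1}" if "l \<in> {..?N} \<times> UNIV" for n l
    using that sol(1) le1 by (auto simp: u_def)
  have fin: "finite ({..?N} \<times> (UNIV :: bool set))" by simp
  obtain \<phi>1 :: "nat \<Rightarrow> nat" and L where \<phi>1: "strict_mono \<phi>1"
    and L: "\<And>l. l \<in> {..?N} \<times> UNIV \<Longrightarrow> (\<lambda>n. u (\<phi>1 n) l) \<longlonglongrightarrow> L l"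
    using bounded_finite_convergent_subseq[where u = u, OF fin ub] by blast
  define \<phi> where "\<phi> = \<phi>0 \<circ> \<phi>1"
  have \<phi>: "strict_mono \<phi>" unfolding \<phi>_def by (intro strict_mono_o \<phi>0 \<phi>1)
  define P where "P i = L (i, True)" for i
  define M where "M i = L (i, False)" for i
  have P: "(\<lambda>n. p (\<phi> n) i) \<longlonglongrightarrow> P i" and M: "(\<lambda>n. m (\<phi> n) i) \<longlonglongrightarrow> M i" if "i \<le> ?N" for i
    using L[of "(i, True)"] L[of "(i, False)"] that by (simp_all add: u_def \<phi>_def P_def M_def)
  have const: "jp (\<phi> n) i = jp n0 i" "jm (\<phi> n) i = jm n0 i" "\<sigma> (\<phi> n) i = \<sigma> n0 i" if "i \<le> ?N" for n i
  proof -
    have eq: "pat (\<phi> n) = pat n0" using \<phi>0(2) by (simp add: \<phi>_def)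
    show "jp (\<phi> n) i = jp n0 i" "jm (\<phi> n) i = jm n0 i" "\<sigma> (\<phi> n) i = \<sigma> n0 i"
      using eq that unfolding pat_def by (auto dest!: fun_cong[of _ _ i])
  qed
  have inv0: "(\<lambda>n. 1 / real (Suc (\<phi> n))) \<longlonglongrightarrow> 0"
    using LIMSEQ_subseq_LIMSEQ[OF lim_inverse_n'[THEN LIMSEQ_Suc] \<phi>] by (simp add: o_def)
  \<comment> \<open>A recorded sign 1 or -1 demands that weak sign at the limit point; a recorded 0
    allows both \<open>\<tau>\<close> and so demands incidence with the hyperplane. A strict sign at
    \<open>Q\<close> must therefore be the recorded one.\<close>
  define I where "I = {(i, \<tau>). i \<le> ?N \<and> \<tau> \<in> {1, -1 :: real} \<and> \<tau> * \<sigma> n0 i \<ge> 0}"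
  have "finite I" by (rule finite_subset[of _ "{..?N} \<times> {1, -1}"]) (auto simp: I_def)
  have "\<exists>Q. \<forall>l\<in>I. (snd l *\<^sub>R a (fst l)) \<bullet> Q \<le> snd l * b (fst l)"
  proof (rule affine_system_limit_feasible[OF \<open>finite I\<close>])
    fix \<epsilon> :: real assume "\<epsilon> > 0"
    then obtain n where n: "\<delta> (\<phi> n) < \<epsilon>"
      using order_tendstoD(2)[OF inv0] by (auto simp: \<delta>_def eventually_sequentially)
    have pos: "\<delta> (\<phi> n) > 0" by (simp add: \<delta>_def)
    have "(snd l *\<^sub>R a (fst l)) \<bullet> q (\<phi> n) \<le> snd l * b (fst l) + \<epsilon>" if "l \<in> I" for l
    proof -
      obtain i \<tau> where l: "l = (i, \<tau>)" "i \<le> ?N" "\<tau> = 1 \<or> \<tau> = -1" "\<tau> * \<sigma> (\<phi> n) i \<ge> 0"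
        using \<open>l \<in> I\<close> const(3) by (auto simp: I_def)
      then have "\<tau> * s (q (\<phi> n)) i \<ge> - \<epsilon>"
        using n pos by (auto simp: \<sigma>_def split: if_splits)
      then show ?thesis by (simp add: l(1) s_def algebra_simps)
    qed
    then show "\<exists>Q. \<forall>l\<in>I. (snd l *\<^sub>R a (fst l)) \<bullet> Q \<le> snd l * b (fst l) + \<epsilon>" by blast
  qed
  then obtain Q where Q: "\<And>i \<tau>. (i, \<tau>) \<in> I \<Longrightarrow> \<tau> * (a i \<bullet> Q) \<le> \<tau> * b i" by fastforce
  have \<sigma>val: "\<sigma> n0 i \<in> {1, -1, 0}" for i by (simp add: \<sigma>_def)
  have pos_side: "M i = 0" if "i \<le> ?N" "b i - a i \<bullet> Q > 0" for i
  proof -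
    have "(i, -1) \<notin> I" using Q[of i "-1"] that by auto
    then have "\<sigma> n0 i = 1" using \<sigma>val[of i] that by (auto simp: I_def)
    then have "s (q (\<phi> n)) i \<ge> \<delta> (\<phi> n)" for n
      using const(3)[OF that(1), of n] by (auto simp: \<sigma>_def split: if_splits)
    then have "(\<lambda>n. m (\<phi> n) i) = (\<lambda>n. 0)" using sol(2)[OF that(1)] by blast
    then show ?thesis using M[OF that(1)] LIMSEQ_unique tendsto_const by metis
  qed
  have neg_side: "P i = 0" if "i \<le> ?N" "b i - a i \<bullet> Q < 0" for i
  proof -
    have "(i, 1) \<notin> I" using Q[of i 1] that by auto
    then have "\<sigma> n0 i = -1" using \<sigma>val[of i] that by (auto simp: I_def)
    then have "s (q (\<phi> n)) i \<le> - \<delta> (\<phi> n)" for n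
      using const(3)[OF that(1), of n] by (auto simp: \<sigma>_def split: if_splits)
    then have "(\<lambda>n. p (\<phi> n) i) = (\<lambda>n. 0)" using sol(3)[OF that(1)] by blast
    then show ?thesis using P[OF that(1)] LIMSEQ_unique tendsto_const by metis
  qed
  have null: "l = 0" if "f \<longlonglongrightarrow> l" "\<And>n. \<bar>f n\<bar> \<le> B / real (Suc (\<phi> n))" for f :: "nat \<Rightarrow> real" and l
  proof -
    have "(\<lambda>n. B / real (Suc (\<phi> n))) \<longlonglongrightarrow> 0"
      using tendsto_mult_right_zero[OF inv0, of B] by simp
    then have "f \<longlonglongrightarrow> 0" using that(2) by (intro Lim_null_comparison[of f]) auto
    then show ?thesis using that(1) LIMSEQ_unique by blast
  qed
  have one: "(\<Sum>i\<le>?N. P i + M i) = 1"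
  proof -
    have "(\<lambda>n. \<Sum>i\<le>?N. p (\<phi> n) i + m (\<phi> n) i) \<longlonglongrightarrow> (\<Sum>i\<le>?N. P i + M i)"
      by (intro tendsto_sum tendsto_add P M) auto
    then show ?thesis unfolding sol(4) using LIMSEQ_unique tendsto_const by metis
  qed
  have Keq: "(\<Sum>i\<le>?N. P i * c i True (jp n0 i) k + M i * c i False (jm n0 i) k) = 0" if "k \<in> K" for k
  proof (rule null)
    show "(\<lambda>n. \<Sum>i\<le>?N. p (\<phi> n) i * c i True (jp n0 i) k + m (\<phi> n) i * c i False (jm n0 i) k)
      \<longlonglongrightarrow> (\<Sum>i\<le>?N. P i * c i True (jp n0 i) k + M i * c i False (jm n0 i) k)"
      by (intro tendsto_sum tendsto_add tendsto_mult tendsto_const P M) auto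
    show "\<bar>\<Sum>i\<le>?N. p (\<phi> n) i * c i True (jp n0 i) k + m (\<phi> n) i * c i False (jm n0 i) k\<bar> \<le> B / real (Suc (\<phi> n))" for n
      using sol(5)[OF that, of "\<phi> n"] const by simp
  qed
  have Beq: "(\<Sum>i\<le>?N. (P i - M i) *\<^sub>R a i) = 0"
  proof (rule euclidean_eqI)
    fix e :: 'a assume e: "e \<in> Basis"
    have "(\<Sum>i\<le>?N. (P i - M i) * (a i \<bullet> e)) = 0"
    proof (rule null)
      show "(\<lambda>n. \<Sum>i\<le>?N. (p (\<phi> n) i - m (\<phi> n) i) * (a i \<bullet> e)) \<longlonglongrightarrow> (\<Sum>i\<le>?N. (P i - M i) * (a i \<bullet> e))"
        by (intro tendsto_sum tendsto_diff tendsto_mult tendsto_const P M) auto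
      show "\<bar>\<Sum>i\<le>?N. (p (\<phi> n) i - m (\<phi> n) i) * (a i \<bullet> e)\<bar> \<le> B / real (Suc (\<phi> n))" for n
        using sol(6)[OF e] .
    qed
    then show "(\<Sum>i\<le>?N. (P i - M i) *\<^sub>R a i) \<bullet> e = 0 \<bullet> e" by (simp add: inner_sum_left)
  qed
  have nn: "P i \<ge> 0" "M i \<ge> 0" if "i \<le> ?N" for i
    using LIMSEQ_le_const[OF P[OF that], of 0] LIMSEQ_le_const[OF M[OF that], of 0] sol(1)[OF that] by auto
  have jJ: "jp n0 i \<in> J" "jm n0 i \<in> J" if "i \<le> ?N" for i
    using sol(1)[OF that] by auto
  show thesis
    by (rule that[OF nn jJ pos_side neg_side one Keq Beq])
qed

section \<open>Merging parts that share a hyperplane\<close>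

section \<open>Hyperplanes through the common point\<close>

text \<open>The coefficient of the normal \<open>a i\<close> in the sum of part \<open>j\<close>:
  weight \<open>p i\<close> stands for \<open>a i\<close> and weight \<open>m i\<close> for
  \<open>- a i\<close>.\<close>

definition half_coeff :: "('i \<Rightarrow> real) \<Rightarrow> ('i \<Rightarrow> real) \<Rightarrow> ('i \<Rightarrow> 'j) \<Rightarrow> ('i \<Rightarrow> 'j) \<Rightarrow> 'j \<Rightarrow> 'i \<Rightarrow> real" where
  "half_coeff p m jp jm j i = (if jp i = j then p i else 0) - (if jm i = j then m i else 0)"

text \<open>Here \<open>p i\<close> belongs to part \<open>jp i\<close> and \<open>m i\<close> to part \<open>jm i\<close>; only hyperplanes with \<open>s i = 0\<close>
  can have both weights positive.\<close>

lemma distribute_wildcards: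
  fixes a :: "'i \<Rightarrow> 'a::euclidean_space" and s :: "'i \<Rightarrow> real" and J :: "'j set"
  assumes "finite I" "finite J"
    and "\<And>i. i \<in> I \<Longrightarrow> a i \<noteq> 0"
    and "\<And>i. i \<in> I \<Longrightarrow> p i \<ge> 0" "\<And>i. i \<in> I \<Longrightarrow> m i \<ge> 0"
    and "\<And>i. i \<in> I \<Longrightarrow> s i > 0 \<Longrightarrow> m i = 0" "\<And>i. i \<in> I \<Longrightarrow> s i < 0 \<Longrightarrow> p i = 0"
    and "\<And>j. j \<in> J \<Longrightarrow> (\<Sum>i\<in>I. half_coeff p m jp jm j i *\<^sub>R a i) = 0"
    and "\<And>j. j \<in> J \<Longrightarrow> \<exists>i\<in>I. jp i = j \<and> p i > 0 \<or> jm i = j \<and> m i > 0"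
  shows "\<exists>f. \<forall>j\<in>J. \<forall>v. \<exists>i\<in>I. f i = j \<and> s i * (a i \<bullet> v) \<ge> 0"
  using assms
proof (induction "card J" arbitrary: J I p m jp jm)
  case 0
  then show ?case by simp
next
  case (Suc c)
  note prems = Suc.prems
  \<comment> \<open>Among the parts in \<open>J\<close>, either no hyperplane through the point
    carries weight, or one of them can be given to a part without affecting the others, or one is
    shared by two parts. The last two cases lower the number of parts.\<close>
  consider
      (definite) "\<And>i. i \<in> I \<Longrightarrow> s i = 0 \<Longrightarrow> \<not> (jp i \<in> J \<and> p i > 0) \<and> \<not> (jm i \<in> J \<and> m i > 0)"
    | (single) i j where "i \<in> I" "s i = 0" "j \<in> J" 
        "\<And>j'. j' \<in> J \<Longrightarrow> j' \<noteq> j \<Longrightarrow> (jp i = j' \<longrightarrow> p i = 0) \<and> (jm i = j' \<longrightarrow> m i = 0)"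
    | (merge) i j j' where "i \<in> I" "s i = 0" "j \<in> J" "j' \<in> J" "j \<noteq> j'"
        "jp i = j" "p i > 0" "jm i = j'" "m i > 0"
  proof -
    show thesis
    proof (cases "\<exists>i\<in>I. s i = 0 \<and> (jp i \<in> J \<and> p i > 0 \<or> jm i \<in> J \<and> m i > 0)")
      case False
      then show thesis using definite by blast
    next
      case True
      then obtain i where i: "i \<in> I" "s i = 0" "jp i \<in> J \<and> p i > 0 \<or> jm i \<in> J \<and> m i > 0" by blast
      have nn: "p i = 0 \<or> p i > 0" "m i = 0 \<or> m i > 0" using prems(4,5)[OF i(1)] by auto
      show thesis
      proof (cases "jp i \<in> J \<and> p i > 0 \<and> jm i \<in> J \<and> m i > 0 \<and> jp i \<noteq> jm i")
        case True
        then show thesis using merge i by blast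
      next
        case False
        then show thesis
          using i nn single[of i "jp i"] single[of i "jm i"] by metis
      qed
    qed
  qed
  then show ?case
  proof cases
    case definite
    \<comment> \<open>Only the weight on the side given by the sign of \<open>s i\<close> can matter
      here. If part \<open>j\<close> failed in direction \<open>v\<close>, all its terms would be
      nonpositive and one negative, although they sum to 0.\<close>
    define f where "f i = (if s i > 0 then jp i else jm i)" for i
    have "\<exists>i\<in>I. f i = j \<and> s i * (a i \<bullet> v) \<ge> 0" if j: "j \<in> J" for j v
    proof (rule ccontr)
      assume neg: "\<not> ?thesis"
      let ?k = "half_coeff p m jp jm j"
      have key: "?k i * (a i \<bullet> v) \<le> 0 \<and>
          (jp i = j \<and> p i > 0 \<or> jm i = j \<and> m i > 0 \<longrightarrow> ?k i * (a i \<bullet> v) < 0)" if i: "i \<in> I" for i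
      proof -
        consider "s i = 0" | "s i > 0" | "s i < 0" by linarith
        then show ?thesis
        proof cases
          case 1
          then show ?thesis using definite[OF i] j prems(4,5)[OF i] by (auto simp: half_coeff_def)
        next
          case 2
          have "jp i = j \<Longrightarrow> a i \<bullet> v < 0"
            using neg i 2 by (force simp: f_def zero_le_mult_iff)
          then show ?thesis using 2 prems(4,6)[OF i]
            by (auto simp: half_coeff_def mult_le_0_iff mult_less_0_iff)
        next
          case 3
          have "jm i = j \<Longrightarrow> a i \<bullet> v > 0"
            using neg i 3 by (force simp: f_def zero_le_mult_iff)
          then show ?thesis using 3 prems(5,7)[OF i]
            by (auto simp: half_coeff_def mult_le_0_iff mult_less_0_iff)
        qed
      qed
      have "(\<Sum>i\<in>I. ?k i * (a i \<bullet> v)) < (\<Sum>i\<in>I. 0)"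
        using key prems(9)[OF j] by (intro sum_strict_mono_ex1 prems(1)) blast+
      moreover have "(\<Sum>i\<in>I. ?k i * (a i \<bullet> v)) = (\<Sum>i\<in>I. ?k i *\<^sub>R a i) \<bullet> v"
        by (simp add: inner_sum_left)
      ultimately show False using prems(8)[OF j] by simp
    qed
    then show ?thesis by blast
  next
    case (single i j)
    \<comment> \<open>As \<open>s i = 0\<close>, hyperplane \<open>i\<close> alone serves part
      \<open>j\<close> in every direction, and the other parts have no weight on it.\<close>
    let ?J = "J - {j}" and ?I = "I - {i}"
    have zero: "half_coeff p m jp jm j' i = 0" if "j' \<in> ?J" for j'
      using single(4)[of j'] that by (auto simp: half_coeff_def)
    have "\<exists>f. \<forall>j\<in>?J. \<forall>v. \<exists>i\<in>?I. f i = j \<and> s i * (a i \<bullet> v) \<ge> 0"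
    proof (rule Suc.hyps(1)[where p = p and m = m and jp = jp and jm = jm])
      show "c = card ?J" using Suc.hyps(2) single(3) prems(2) by simp
      show "(\<Sum>i\<in>?I. half_coeff p m jp jm j' i *\<^sub>R a i) = 0" if "j' \<in> ?J" for j'
        using prems(8)[of j'] zero[OF that] that sum.remove[OF prems(1) single(1), of "\<lambda>i. half_coeff p m jp jm j' i *\<^sub>R a i"]
        by simp
      show "\<exists>i\<in>?I. jp i = j' \<and> p i > 0 \<or> jm i = j' \<and> m i > 0" if "j' \<in> ?J" for j'
        using prems(9)[of j'] that single(4)[of j'] by force
    qed (use prems in auto)
    then obtain f where f: "\<And>j v. j \<in> ?J \<Longrightarrow> \<exists>i\<in>?I. f i = j \<and> s i * (a i \<bullet> v) \<ge> 0" by blast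
    have "\<exists>l\<in>I. (f(i := j)) l = j' \<and> s l * (a l \<bullet> v) \<ge> 0" if "j' \<in> J" for j' v
    proof (cases "j' = j")
      case True
      then show ?thesis using single by (intro bexI[of _ i]) auto
    next
      case False
      then show ?thesis using f[of j' v] that by force
    qed
    then show ?thesis by blast
  next
    case (merge i j j')
    \<comment> \<open>\<open>i\<close> alone becomes part \<open>j'\<close>; the scaling makes its two contributions cancel in the union of
      the rest of \<open>j\<close> and \<open>j'\<close>\<close>
    let ?J = "J - {j'}" and ?I = "I - {i}"
    define wt where "wt k = (if k = j then m i else if k = j' then p i else 1)" for k
    define red where "red k = (if k = j' then j else k)" for k
    define p' m' jp' jm' where defs: "p' l = p l * wt (jp l)" "m' l = m l * wt (jm l)"
      "jp' l = red (jp l)" "jm' l = red (jm l)" for l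
    have cpos: "wt k > 0" for k using merge by (simp add: wt_def)
    have coeff: "half_coeff p' m' jp' jm' k l =
       (if k = j then m i * half_coeff p m jp jm j l + p i * half_coeff p m jp jm j' l
        else half_coeff p m jp jm k l)" if "k \<in> ?J" for k l
      using that merge(5) by (auto simp: half_coeff_def defs wt_def red_def algebra_simps)
    have sum0: "(\<Sum>l\<in>?I. half_coeff p' m' jp' jm' k l *\<^sub>R a l) = 0" if k: "k \<in> ?J" for k
    proof -
      have at_i: "half_coeff p' m' jp' jm' k i = 0"
        unfolding coeff[OF k] using merge k by (auto simp: half_coeff_def)
      have "(\<Sum>l\<in>I. half_coeff p' m' jp' jm' k l *\<^sub>R a l) = 
        (if k = j then m i *\<^sub>R (\<Sum>l\<in>I. half_coeff p m jp jm j l *\<^sub>R a l) + p i *\<^sub>R (\<Sum>l\<in>I. half_coeff p m jp jm j' l *\<^sub>R a l)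
         else (\<Sum>l\<in>I. half_coeff p m jp jm k l *\<^sub>R a l))"
        unfolding coeff[OF k] by (simp add: scaleR_sum_right sum.distrib[symmetric] algebra_simps)
      also have "\<dots> = 0" using prems(8) merge(3,4) k by simp
      finally show ?thesis
        using at_i sum.remove[OF prems(1) merge(1), of "\<lambda>l. half_coeff p' m' jp' jm' k l *\<^sub>R a l"] by simp
    qed
    have "\<exists>f. \<forall>j\<in>?J. \<forall>v. \<exists>i\<in>?I. f i = j \<and> s i * (a i \<bullet> v) \<ge> 0"
    proof (rule Suc.hyps(1)[where p = p' and m = m' and jp = jp' and jm = jm'])
      show "c = card ?J" using Suc.hyps(2) merge(4) prems(2) by simp
      show "\<exists>l\<in>?I. jp' l = k \<and> p' l > 0 \<or> jm' l = k \<and> m' l > 0" if k: "k \<in> ?J" for k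
      proof (cases "k = j")
        case False
        then have "k \<noteq> jp i" "k \<noteq> jm i" using merge k by auto
        then obtain l where "l \<in> ?I" "jp l = k \<and> p l > 0 \<or> jm l = k \<and> m l > 0" 
          using prems(9)[of k] k by force
        then show ?thesis
            using False k cpos by (intro bexI[of _ l]) (auto simp: defs red_def)
      next
        case True
        \<comment> \<open>The merged part keeps some weight: otherwise the zero sum of part
          \<open>j\<close> would be \<open>p i *\<^sub>R a i\<close>, which is nonzero.\<close>
        show ?thesis
        proof (rule ccontr)
          assume neg: "\<not> ?thesis"
          have "half_coeff p m jp jm j l = 0" if l: "l \<in> ?I" for l
          proof -
            have nl: "\<not> (jp' l = k \<and> p' l > 0)" "\<not> (jm' l = k \<and> m' l > 0)"
              using neg l by blast+
            have "jp l = j \<Longrightarrow> \<not> p l > 0" "jm l = j \<Longrightarrow> \<not> m l > 0"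
              using nl True merge(5) cpos by (auto simp: defs red_def)
            moreover have "p l \<ge> 0" "m l \<ge> 0" using prems(4,5) l by auto
            ultimately have "jp l = j \<Longrightarrow> p l = 0" "jm l = j \<Longrightarrow> m l = 0" by linarith+
            then show ?thesis by (simp add: half_coeff_def)
          qed
          then have "(\<Sum>l\<in>I. half_coeff p m jp jm j l *\<^sub>R a l) = half_coeff p m jp jm j i *\<^sub>R a i"
            using sum.remove[OF prems(1) merge(1), of "\<lambda>l. half_coeff p m jp jm j l *\<^sub>R a l"] by simp
          then show False
            using prems(8)[OF merge(3)] prems(3)[OF merge(1)] merge by (auto simp: half_coeff_def)
        qed
      qed
    qed (use prems Suc.hyps(2) sum0 cpos in \<open>auto simp: defs less_imp_le\<close>)
    then obtain f where f: "\<And>j v. j \<in> ?J \<Longrightarrow> \<exists>i\<in>?I. f i = j \<and> s i * (a i \<bullet> v) \<ge> 0" by blast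
    have "\<exists>l\<in>I. (f(i := j')) l = k \<and> s l * (a l \<bullet> v) \<ge> 0" if "k \<in> J" for k v
    proof (cases "k = j'")
      case True
      then show ?thesis using merge by (intro bexI[of _ i]) auto
    next
      case False
      then show ?thesis using f[of k v] that by force
    qed
    then show ?thesis by blast
  qed
qed

section \<open>Sarkaria's tensor trick\<close>

section \<open>Tverberg partitions for regression depth\<close>

text \<open>The tensor space has dimension \<open>N\<close>, matching the \<open>N + 1\<close>
  colours. A zero there makes the lifted totals of all parts equal; as they sum to
  \<open>(0, 1)\<close>, each part is balanced and has positive height, hence positive
  weight.\<close>

lemma tverberg_balanced_weights:
  fixes a :: "nat \<Rightarrow> 'a::euclidean_space" and b :: "nat \<Rightarrow> real" and r :: nat
  assumes r: "r \<ge> 1"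
  defines "N \<equiv> (r - 1) * (DIM('a) + 1)"
  obtains q p m jp jm where
    "\<And>i. i \<le> N \<Longrightarrow> p i \<ge> 0" "\<And>i. i \<le> N \<Longrightarrow> m i \<ge> 0"
    "\<And>i. i \<le> N \<Longrightarrow> b i - a i \<bullet> q > 0 \<Longrightarrow> m i = 0"
    "\<And>i. i \<le> N \<Longrightarrow> b i - a i \<bullet> q < 0 \<Longrightarrow> p i = 0"
    "\<And>j. j < r \<Longrightarrow> (\<Sum>i\<le>N. half_coeff p m jp jm j i *\<^sub>R a i) = 0"
    "\<And>j. j < r \<Longrightarrow> \<exists>i\<in>{..N}. jp i = j \<and> p i > 0 \<or> jm i = j \<and> m i > 0"
proof -
  define K where "K = {..<r - 1} \<times> (Basis :: ('a \<times> real) set)"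
  have K: "finite K" "card K = N" by (simp_all add: K_def N_def card_cartesian_product)
  \<comment> \<open>Sarkaria's vectors: the lift of \<open>\<plusminus> a i\<close> to height 1 is placed in block \<open>j\<close>, and part \<open>r - 1\<close>
    stands for minus the sum of all blocks, so that a zero has equal totals in all parts\<close>
  define h where "h i s = (if s then a i else - a i, 1 :: real)" for i s
  define sgn' where "sgn' j l = (if j = l then 1 else if j = r - 1 then -1 else 0 :: real)" for j l
  define c where "c i s j k = sgn' j (fst k) * (h i s \<bullet> snd k)" for i s j and k :: "nat \<times> ('a \<times> real)"
  \<comment> \<open>Choose a block on which the pairing is nonpositive; if there is none, all are
    positive and part \<open>r - 1\<close>, which carries minus their sum, works.\<close>
  have half: "\<exists>j\<in>{..<r}. (\<Sum>k\<in>K. c i s j k * X k) \<le> 0" for i s X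
  proof -
    define Y where "Y l = (\<Sum>e\<in>Basis. (h i s \<bullet> e) * X (l, e))" for l
    have eq: "(\<Sum>k\<in>K. c i s j k * X k) = (\<Sum>l<r - 1. sgn' j l * Y l)" for j
      unfolding K_def Y_def c_def
      by (simp add: sum.cartesian_product sum_distrib_left mult.assoc split_def)
    show ?thesis
    proof (cases "\<exists>l<r - 1. Y l \<le> 0")
      case True
      then obtain l where l: "l < r - 1" "Y l \<le> 0" by blast
      have "(\<Sum>l'<r - 1. sgn' l l' * Y l') = (\<Sum>l'<r - 1. if l' = l then Y l' else 0)"
        using l by (intro sum.cong) (auto simp: sgn'_def)
      also have "\<dots> = Y l" using l by simp
      finally show ?thesis using l eq[of l] by (intro bexI[of _ l]) auto
    next
      case False
      then have "(\<Sum>l<r - 1. sgn' (r - 1) l * Y l) \<le> 0"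
        by (intro sum_nonpos) (auto simp: sgn'_def not_le)
      then show ?thesis using r eq[of "r - 1"] by (intro bexI[of _ "r - 1"]) auto
    qed
  qed
  obtain q p m jp jm where
    pn: "\<And>i. i \<le> N \<Longrightarrow> p i \<ge> 0" and mn: "\<And>i. i \<le> N \<Longrightarrow> m i \<ge> 0" and
    jp: "\<And>i. i \<le> N \<Longrightarrow> jp i \<in> {..<r}" and jm: "\<And>i. i \<le> N \<Longrightarrow> jm i \<in> {..<r}" and
    pos: "\<And>i. i \<le> N \<Longrightarrow> b i - a i \<bullet> q > 0 \<Longrightarrow> m i = 0" and
    neg: "\<And>i. i \<le> N \<Longrightarrow> b i - a i \<bullet> q < 0 \<Longrightarrow> p i = 0" and
    one: "(\<Sum>i\<le>N. p i + m i) = 1" and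
    Keq: "\<And>k. k \<in> K \<Longrightarrow> (\<Sum>i\<le>N. p i * c i True (jp i) k + m i * c i False (jm i) k) = 0" and
    tot: "(\<Sum>i\<le>N. (p i - m i) *\<^sub>R a i) = 0"
  proof (rule colourful_solution[where c = c and b = b and a = a, OF K(1) finite_lessThan half, unfolded K(2)], goal_cases)
    case 1
    show thesis by (rule 1(1)[OF 1(2-)])
  qed
  define T where "T j = (\<Sum>i\<le>N. (if jp i = j then p i else 0) *\<^sub>R h i True + (if jm i = j then m i else 0) *\<^sub>R h i False)" for j
  have T_eq: "T l = T (r - 1)" if l: "l < r - 1" for l
  proof (rule euclidean_eqI)
    fix e :: "'a \<times> real" assume e: "e \<in> Basis"
    have sg: "x * (sgn' j l * y) = (if j = l then x else 0) * y - (if j = r - 1 then x else 0) * y" for x y j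
      using l by (simp add: sgn'_def)
    have "T l \<bullet> e - T (r - 1) \<bullet> e = (\<Sum>i\<le>N. p i * c i True (jp i) (l, e) + m i * c i False (jm i) (l, e))"
      unfolding T_def c_def fst_conv snd_conv sg inner_sum_left inner_add_left inner_scaleR_left sum_subtractf[symmetric]
      by (intro sum.cong) auto
    also have "\<dots> = 0" using l e by (intro Keq) (simp add: K_def)
    finally show "T l \<bullet> e = T (r - 1) \<bullet> e" by simp
  qed
  have T_const: "T j = T (r - 1)" if "j < r" for j
    using T_eq[of j] that by (cases "j = r - 1") auto
  have "(\<Sum>j<r. T j) = (\<Sum>i\<le>N. p i *\<^sub>R h i True + m i *\<^sub>R h i False)"
  proof -
    have "(\<Sum>j<r. (if jp i = j then p i else 0) *\<^sub>R h i True + (if jm i = j then m i else 0) *\<^sub>R h i False)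
      = p i *\<^sub>R h i True + m i *\<^sub>R h i False" if "i \<le> N" for i
      using jp[OF that] jm[OF that] by (simp add: sum.distrib scaleR_sum_left[symmetric])
    then show ?thesis unfolding T_def by (subst sum.swap) simp
  qed
  \<comment> \<open>The heights add up to the total weight 1. The normals cancel by
    \<open>tot\<close>, the equation contributed by the coordinates of \<open>q\<close>.\<close>
  also have "\<dots> = (0, 1)"
  proof -
    have "p i *\<^sub>R h i True + m i *\<^sub>R h i False = ((p i - m i) *\<^sub>R a i, p i + m i)" for i
      by (simp add: h_def algebra_simps)
    then show ?thesis using one tot by (simp add: sum_prod)
  qed
  finally have "(\<Sum>j<r. T j) = (0, 1)" .
  moreover have "(\<Sum>j<r. T j) = (\<Sum>j<r. T (r - 1))"
    by (intro sum.cong refl T_const) simp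
  ultimately have rT: "real r *\<^sub>R T (r - 1) = (0, 1)"
    by (simp add: sum_constant_scaleR)
  have Tj: "fst (T j) = 0" "snd (T j) \<noteq> 0" if "j < r" for j
  proof -
    have "real r *\<^sub>R fst (T j) = 0" "real r * snd (T j) = 1"
      using rT T_const[OF that] by (simp_all add: prod_eq_iff)
    then show "fst (T j) = 0" "snd (T j) \<noteq> 0" using r by auto
  qed
  show thesis
  proof (rule that[where p = p and m = m and q = q and jp = jp and jm = jm])
    fix j assume j: "j < r"
    have "(\<Sum>i\<le>N. half_coeff p m jp jm j i *\<^sub>R a i) = fst (T j)"
      unfolding T_def fst_sum half_coeff_def by (intro sum.cong) (auto simp: h_def algebra_simps)
    then show "(\<Sum>i\<le>N. half_coeff p m jp jm j i *\<^sub>R a i) = 0" using Tj j by simp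
    show "\<exists>i\<in>{..N}. jp i = j \<and> p i > 0 \<or> jm i = j \<and> m i > 0"
    proof (rule ccontr)
      assume none: "\<not> ?thesis"
      have "(jp i = j \<longrightarrow> p i = 0) \<and> (jm i = j \<longrightarrow> m i = 0)" if "i \<in> {..N}" for i
      proof -
        have "\<not> (jp i = j \<and> p i > 0)" "\<not> (jm i = j \<and> m i > 0)" using none that by blast+
        then show ?thesis using pn[of i] mn[of i] that by auto
      qed
      then have "T j = 0" unfolding T_def by (intro sum.neutral) simp
      then show False using Tj[OF j] by simp
    qed
  qed (use pn mn pos neg in auto)
qed

section \<open>From sign conditions to regression depth\<close>

lemma regression_depth_ge_1I:
  fixes q :: "'a::euclidean_space"
  assumes "finite P" and hits: "\<And>v. v \<noteq> 0 \<Longrightarrow> \<exists>H\<in>P. ray_hits q v H"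
  shows "regression_depth P q \<ge> 1"
proof -
  \<comment> \<open>Without a nonzero direction the infimum would range over the empty set.\<close>
  have "{v :: 'a. v \<noteq> 0} \<noteq> {}" using nonempty_Basis nonzero_Basis by blast
  moreover have "1 \<le> card {H \<in> P. ray_hits q v H}" if "v \<in> {v. v \<noteq> 0}" for v
    using hits[of v] that assms(1) by (auto simp: Suc_le_eq card_gt_0_iff)
  ultimately show ?thesis unfolding regression_depth_def by (rule cINF_greatest)
qed

text \<open>If \<open>a \<bullet> v\<close> is nonzero, the line meets the hyperplane at parameter
  \<open>(b - a \<bullet> q) / (a \<bullet> v)\<close>, whose sign is that of the product; otherwise
  the ray is parallel to it.\<close>

lemma ray_hits_hyperplane:
  fixes a q v :: "'a::euclidean_space"
  assumes "(b - a \<bullet> q) * (a \<bullet> v) \<ge> 0"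
  shows "ray_hits q v {x. a \<bullet> x = b}"
proof (cases "a \<bullet> v = 0")
  case True
  then show ?thesis by (simp add: ray_hits_def inner_add_right)
next
  case False
  let ?t = "(b - a \<bullet> q) / (a \<bullet> v)"
  have "?t \<ge> 0" using assms False by (auto simp: zero_le_mult_iff zero_le_divide_iff)
  moreover have "a \<bullet> (q + ?t *\<^sub>R v) = b" using False by (simp add: inner_add_right)
  ultimately have "q + ?t *\<^sub>R v \<in> ray q v \<inter> {x. a \<bullet> x = b}" unfolding ray_def by blast
  then show ?thesis unfolding ray_hits_def by blast
qed

theorem theorem1:
  fixes A :: "'a::euclidean_space set set" and r :: nat
  assumes "r \<ge> 1"
    and "arrangement A"
    and "card A \<ge> (r - 1) * (DIM('a) + 1) + 1"
  shows "\<exists>q::'a. \<exists>P :: nat \<Rightarrow> 'a set set.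
           (\<Union>j\<in>{1..r}. P j) = A
         \<and> (\<forall>i\<in>{1..r}. \<forall>j\<in>{1..r}. i \<noteq> j \<longrightarrow> P i \<inter> P j = {})
         \<and> (\<forall>j\<in>{1..r}. regression_depth (P j) q \<ge> 1)"
proof -
  define N where "N = (r - 1) * (DIM('a) + 1)"
  have finA: "finite A" and hyp: "\<And>H. H \<in> A \<Longrightarrow> is_hyperplane H"
    using assms(2) by (auto simp: arrangement_def)
  obtain A' where A': "A' \<subseteq> A" "card A' = Suc N"
    using obtain_subset_with_card_n[OF assms(3)] unfolding N_def by (metis Suc_eq_plus1)
  then have finA': "finite A'" using finA finite_subset by blast
  obtain H where H: "bij_betw H {..N} A'"
    using ex_bij_betw_nat_finite[OF finA'] A'(2) by (auto simp: atLeast0LessThan lessThan_Suc_atMost)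
  have HA: "H i \<in> A" if "i \<le> N" for i using H A'(1) that by (auto simp: bij_betw_def)
  have "\<exists>a b. a \<noteq> 0 \<and> H i = {x. a \<bullet> x = b}" if "i \<le> N" for i
    using hyp[OF HA[OF that]] by (simp add: is_hyperplane_def)
  then obtain a b where ab: "\<And>i. i \<le> N \<Longrightarrow> a i \<noteq> 0" "\<And>i. i \<le> N \<Longrightarrow> H i = {x. a i \<bullet> x = b i}"
    by metis
  obtain q p m and jp jm :: "nat \<Rightarrow> nat" where w:
    "\<And>i. i \<le> N \<Longrightarrow> p i \<ge> 0" "\<And>i. i \<le> N \<Longrightarrow> m i \<ge> 0"
    "\<And>i. i \<le> N \<Longrightarrow> b i - a i \<bullet> q > 0 \<Longrightarrow> m i = 0"
    "\<And>i. i \<le> N \<Longrightarrow> b i - a i \<bullet> q < 0 \<Longrightarrow> p i = 0"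
    "\<And>j. j < r \<Longrightarrow> (\<Sum>i\<le>N. half_coeff p m jp jm j i *\<^sub>R a i) = 0"
    "\<And>j. j < r \<Longrightarrow> \<exists>i\<in>{..N}. jp i = j \<and> p i > 0 \<or> jm i = j \<and> m i > 0"
  proof (rule tverberg_balanced_weights[where a = a and b = b, OF assms(1), folded N_def], goal_cases)
    case 1
    show thesis by (rule 1(1)[OF 1(2-)])
  qed
  have "\<exists>f. \<forall>j\<in>{..<r}. \<forall>v. \<exists>i\<in>{..N}. f i = j \<and> (b i - a i \<bullet> q) * (a i \<bullet> v) \<ge> 0"
    by (rule distribute_wildcards[of "{..N}" "{..<r}" a p m _ jp jm])
      (simp_all only: atMost_iff lessThan_iff finite_atMost finite_lessThan w ab(1) not_False_eq_True)
  then obtain f where "\<forall>j\<in>{..<r}. \<forall>v. \<exists>i\<in>{..N}. f i = j \<and> (b i - a i \<bullet> q) * (a i \<bullet> v) \<ge> 0"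
    by blast
  then have f: "\<exists>i\<le>N. f i = j \<and> (b i - a i \<bullet> q) * (a i \<bullet> v) \<ge> 0" if "j < r" for j v
    using that by auto
  \<comment> \<open>Parts are numbered from 1, the values of \<open>f\<close> from 0. Hyperplanes
    outside \<open>A'\<close>, and those for which \<open>f\<close> names no part, go to part 1,
    where extra hyperplanes do no harm.\<close>
  define part where "part G = (if G \<in> A' \<and> f (inv_into {..N} H G) < r
      then Suc (f (inv_into {..N} H G)) else 1)" for G
  have partH: "part (H i) = Suc (f i)" if "i \<le> N" "f i < r" for i
    using H that by (auto simp: part_def bij_betw_def)
  have part_range: "part G \<in> {1..r}" for G using assms(1) by (auto simp: part_def)
  define P where "P j = {G \<in> A. part G = j}" for j
  have "regression_depth (P j) q \<ge> 1" if j: "j \<in> {1..r}" for j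
  proof (rule regression_depth_ge_1I)
    show "finite (P j)" using finA by (simp add: P_def)
    fix v :: 'a
    have "j - 1 < r" using j by auto
    from f[OF this, of v] obtain i where i: "i \<le> N" "f i = j - 1" "(b i - a i \<bullet> q) * (a i \<bullet> v) \<ge> 0" by blast
    have "part (H i) = j" using partH[OF i(1)] i(2) j by auto
    then have "H i \<in> P j" using HA[OF i(1)] by (simp add: P_def)
    moreover have "ray_hits q v (H i)" unfolding ab(2)[OF i(1)] by (rule ray_hits_hyperplane) (rule i(3))
    ultimately show "\<exists>H\<in>P j. ray_hits q v H" by blast
  qed
  moreover have "(\<Union>j\<in>{1..r}. P j) = A" using part_range by (auto simp: P_def)
  moreover have "\<forall>i\<in>{1..r}. \<forall>j\<in>{1..r}. i \<noteq> j \<longrightarrow> P i \<inter> P j = {}" by (auto simp: P_def)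
  ultimately show ?thesis by blast
qed

end
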